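(* There is an absolute constant $c>0$ such that for all integers $n\ge 2$ and $s\ge 1$ with $s\le \log\log n+2$, we have $\lambda(s,n)\ge c\, n\, 2^s$; that is, $\lambda(s,n)=\Omega(n\cdot 2^s)$.
   Context: A sequence $S$ over an alphabet is an order-$s$ Davenport–Schinzel sequence if it contains no immediate repetition (no two equal consecutive symbols) and contains no alternating subsequence $a\,b\,a\,b\cdots$ (with $a\neq b$) of length $s+2$. Let $DS(s,n)$ be the set of order-$s$ Davenport–Schinzel sequences using exactly $n$ distinct symbols, and $\lambda(s,n)=\max\{|S| : S\in DS(s,n)\}$, where $|S|$ is the length of $S$. Logarithms are base 2. *)

theory Defs
  imports Complex_Main "HOL-Library.Sublist"
begin

fun alternation :: "'a \<Rightarrow> 'a \<Rightarrow> nat \<Rightarrow> 'a list" where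
  "alternation a b 0 = []"
| "alternation a b (Suc k) = a # alternation b a k"

definition DS :: "nat \<Rightarrow> nat \<Rightarrow> 'a list set" where
  "DS s n = {S. card (set S) = n \<and> distinct_adj S \<and>
                (\<forall>a b. a \<noteq> b \<longrightarrow> \<not> subseq (alternation a b (s + 2)) S)}"

text \<open>The alphabet is irrelevant up to renaming of symbols; natural numbers supply enough
  symbols for every \<open>n\<close>.\<close>

definition ds_lambda :: "nat \<Rightarrow> nat \<Rightarrow> nat" where
  "ds_lambda s n = Max (length ` (DS s n :: nat list set))"

text \<open>The maximum is well defined: an adjacent pair \<open>a b\<close> that occurs \<open>k\<close> times yields an
  alternation of length \<open>2 * k\<close>, so the length is bounded, and for \<open>s \<ge> 1\<close> the sequence of
  \<open>n\<close> distinct symbols is admissible.\<close>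

lemma subseq_alternation_count:
  assumes "distinct_adj S" "a \<noteq> b"
  shows "subseq (alternation a b (2 * count_list (zip S (tl S)) (a, b))) S"
  using assms
proof (induction S rule: length_induct)
  case (1 S)
  show ?case
  proof (cases S)
    case Nil
    then show ?thesis by simp
  next
    case S: (Cons x T)
    show ?thesis
    proof (cases T)
      case Nil
      then show ?thesis using S by simp
    next
      case T: (Cons y U)
      show ?thesis
      proof (cases "x = a \<and> y = b")
        case True
        have "subseq (alternation a b (2 * count_list (zip U (tl U)) (a, b))) U"
          using 1 S T by (auto simp: distinct_adj_Cons)
        moreover have "count_list (zip S (tl S)) (a, b) = Suc (count_list (zip U (tl U)) (a, b))"
          using True S T 1 by (cases U) auto
        ultimately show ?thesis using True S T by simp
      next
        case False
        then have "count_list (zip S (tl S)) (a, b) = count_list (zip T (tl T)) (a, b)"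
          using S T by auto
        moreover have "subseq (alternation a b (2 * count_list (zip T (tl T)) (a, b))) T"
          using 1 S by (auto simp: distinct_adj_Cons)
        ultimately show ?thesis using S by auto
      qed
    qed
  qed
qed

lemma subseq_alternation_mono:
  "k \<le> m \<Longrightarrow> subseq (alternation a b k) (alternation a b m)"
proof (induction k arbitrary: a b m)
  case (Suc k)
  then show ?case by (cases m) auto
qed simp

lemma length_DS_le:
  assumes "S \<in> DS s n"
  shows "length S \<le> n * n * (s + 2) + 1"
proof -
  let ?Z = "zip S (tl S)"
  have S: "distinct_adj S" "card (set S) = n"
    "\<And>a b. a \<noteq> b \<Longrightarrow> \<not> subseq (alternation a b (s + 2)) S"
    using assms by (auto simp: DS_def)
  have ne: "a \<noteq> b" if "(a, b) \<in> set ?Z" for a b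
    using that S(1) by (auto simp: set_zip distinct_adj_conv_nth nth_tl)
  have le: "count_list ?Z p \<le> s + 2" if pZ: "p \<in> set ?Z" for p
  proof (rule ccontr)
    obtain a b where p: "p = (a, b)" by (cases p)
    assume "\<not> ?thesis"
    then have "s + 2 \<le> 2 * count_list ?Z (a, b)" using p by simp
    then show False
      using subseq_alternation_mono subseq_alternation_count[OF S(1)] S(3) ne pZ p
        subseq_order.trans by metis
  qed
  have sub: "set ?Z \<subseteq> set S \<times> set S"
    by (cases S) (auto dest: set_zip_leftD set_zip_rightD)
  have "length ?Z = (\<Sum>p\<in>set ?Z. count_list ?Z p)"
    by (simp only: sum_count_set[OF subset_refl finite_set])
  also have "\<dots> \<le> card (set ?Z) * (s + 2)"
    using sum_bounded_above[of "set ?Z" "count_list ?Z" "s + 2"] le by simp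
  also have "\<dots> \<le> card (set S \<times> set S) * (s + 2)"
    using card_mono[OF _ sub] by (intro mult_right_mono) simp_all
  finally show ?thesis using S(2) by (simp add: card_cartesian_product)
qed

lemma finite_length_DS: "finite (length ` DS s n)"
proof (rule finite_subset)
  show "length ` DS s n \<subseteq> {..n * n * (s + 2) + 1}"
    using length_DS_le by (intro image_subsetI) (simp only: atMost_iff)
qed simp

lemma distinct_subseq: "subseq xs ys \<Longrightarrow> distinct ys \<Longrightarrow> distinct xs"
  by (metis distinct_nthsI subseq_conv_nths)

lemma upt_in_DS:
  assumes "s \<ge> 1"
  shows "[0..<n] \<in> DS s n"
proof -
  have "\<not> subseq (alternation a b (s + 2)) [0..<n]" for a b
  proof
    assume "subseq (alternation a b (s + 2)) [0..<n]"
    then have "distinct (alternation a b (s + 2))"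
      using distinct_subseq distinct_upt by blast
    moreover obtain r where "s = Suc r" using assms by (cases s) auto
    ultimately show False by simp
  qed
  then show ?thesis by (simp add: DS_def distinct_adj_conv_nth)
qed

end

theory Submission
  imports Defs "HOL-Library.Nat_Bijection"
begin

text \<open>
  Let \<open>S\<close> be a sequence of order \<open>s \<ge> 2\<close> on \<open>N\<close> symbols. On the \<open>N \<times> N\<close> grid write a copy of
  \<open>S\<close> on every row and then a copy of \<open>S\<close> on every column. Two grid points share at most one
  line, so a pair on a common line sees one copy of \<open>S\<close> together with one block of each symbol.
  If rows are listed in reverse order of first occurrence in \<open>S\<close>, and columns in reverse order of
  last occurrence in \<open>S\<close>, these two blocks lengthen an alternation by only one. Hence \<open>s\<close>
  becomes \<open>s + 1\<close>, \<open>N\<close> becomes \<open>N\<^sup>2\<close>, and the average number of occurrences per symbol doubles up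
  to the loss of one letter at the seam. Starting from \<open>0 1 0\<close> this reaches order \<open>s\<close> on
  \<open>2 ^ 2 ^ (s - 2)\<close> symbols, and disjoint copies fill up larger alphabets.
\<close>

section \<open>Alternation length by greedy scanning\<close>

text \<open>The length of the longest alternation \<open>a b a ...\<close>: taking the first
  available letter is optimal (\<open>subseq_alternation_iff\<close>). The numeric form makes
  concatenation computable.\<close>

fun alen :: "'a \<Rightarrow> 'a \<Rightarrow> 'a list \<Rightarrow> nat" where
  "alen a b [] = 0"
| "alen a b (x # xs) = (if x = a then Suc (alen b a xs) else alen a b xs)"

lemma alen_le_Suc: "alen a b xs \<le> Suc (alen b a xs)"
proof (induction xs arbitrary: a b)
  case (Cons x xs)
  then show ?case by (auto intro: le_SucI)
qed simp

lemma subseq_alternation_iff: "subseq (alternation a b k) xs \<longleftrightarrow> k \<le> alen a b xs"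
proof (induction xs arbitrary: a b k)
  case Nil
  then show ?case by (cases k) auto
next
  case (Cons x xs)
  show ?case
  proof (cases k)
    case (Suc j)
    then show ?thesis using Cons.IH[of b a j] Cons.IH[of a b "Suc j"] by auto
  qed simp
qed

lemma DS_iff:
  "S \<in> DS s n \<longleftrightarrow> card (set S) = n \<and> distinct_adj S \<and> (\<forall>a b. a \<noteq> b \<longrightarrow> alen a b S \<le> s + 1)"
  by (auto simp: DS_def subseq_alternation_iff not_less_eq_eq
      simp del: alternation.simps)

text \<open>After \<open>xs\<close> the scan waits for \<open>a\<close> if its count is even and for
  \<open>b\<close> if it is odd.\<close>

lemma alen_append:
  "alen a b (xs @ ys) = alen a b xs + (if even (alen a b xs) then alen a b ys else alen b a ys)"
  by (induction xs arbitrary: a b) auto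

lemma alen_notin: "a \<notin> set xs \<Longrightarrow> alen a b xs = 0"
  by (induction xs) auto

lemma alen_le_one: "b \<notin> set xs \<Longrightarrow> alen a b xs \<le> 1"
  using alen_le_Suc[of a b xs] alen_notin[of b xs a] by simp

lemma alen_map: "inj f \<Longrightarrow> alen (f a) (f b) (map f xs) = alen a b xs"
  by (induction xs arbitrary: a b) (auto simp: inj_eq)

text \<open>Restricted to the two letters, the list reads \<open>a ... a b ... b\<close>.\<close>

lemma alen_two_blocks:
  assumes "b \<notin> set P" "a \<notin> set Q"
  shows "alen a b (P @ Q) \<le> 2" "alen b a (P @ Q) \<le> 1"
  using alen_le_one[OF assms(1), of a] alen_le_one[OF assms(2), of b]
    alen_notin[OF assms(1), of a] alen_notin[OF assms(2), of b]
  by (auto simp: alen_append)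

lemma alen_subseq: "subseq xs ys \<Longrightarrow> alen a b xs \<le> alen a b ys"
  using subseq_order.trans[of "alternation a b (alen a b xs)" xs ys]
  by (simp add: subseq_alternation_iff)

lemma DS_map:
  assumes "S \<in> DS s n" "inj f"
  shows "map f S \<in> DS s n"
proof -
  have inj: "inj_on f (set S)" using assms(2) inj_on_subset by blast
  have "alen a b (map f S) \<le> s + 1" if "a \<noteq> b" for a b
  proof (cases "a \<in> range f \<and> b \<in> range f")
    case True
    then obtain a' b' where "a = f a'" "b = f b'" by auto
    moreover from this have "a' \<noteq> b'" using that by auto
    ultimately show ?thesis using assms by (simp add: alen_map DS_iff)
  next
    case False
    then have "a \<notin> set (map f S) \<or> b \<notin> set (map f S)" by auto
    then show ?thesis
      using alen_notin[of a "map f S" b] alen_le_one[of b "map f S" a] by auto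
  qed
  moreover have "distinct_adj (map f S)"
    using assms inj by (simp add: DS_iff distinct_adj_map_iff)
  moreover have "card (set (map f S)) = n"
    using assms inj by (simp add: DS_iff card_image)
  ultimately show ?thesis by (simp add: DS_iff)
qed

section \<open>Disjoint copies of a sequence\<close>

text \<open>Both letters occur only in the block of \<open>z\<close>, which is an injective renaming
  of \<open>S\<close>.\<close>

lemma alen_product_same:
  assumes "distinct zs" "z \<in> set zs"
  shows "alen (z, y) (z, y') (List.product zs S) = alen y y' S"
  using assms
proof (induction zs)
  case (Cons w ws)
  have "inj (Pair z)" by (auto intro: injI)
  from alen_map[OF this]
  have *: "alen (z, u) (z, v) (map (Pair z) S) = alen u v S" for u v .
  show ?case
  proof (cases "w = z")
    case True
    moreover have "alen (z, u) (z, v) (List.product ws S) = 0" for u v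
      using Cons.prems True by (intro alen_notin) auto
    ultimately show ?thesis by (simp add: alen_append *)
  next
    case False
    then have "alen (z, y) (z, y') (map (Pair w) S) = 0" by (intro alen_notin) auto
    then show ?thesis using Cons False by (simp add: alen_append)
  qed
qed simp

lemma product_append: "List.product (xs @ ys) S = List.product xs S @ List.product ys S"
  by (induction xs) auto

lemma alen_product_blocks:
  assumes "distinct (us @ z # vs)" "z' \<in> set vs"
  shows "alen (z, y) (z', y') (List.product (us @ z # vs) S) \<le> 2"
    and "alen (z', y') (z, y) (List.product (us @ z # vs) S) \<le> 1"
proof -
  have eq: "List.product (us @ z # vs) S = List.product (us @ [z]) S @ List.product vs S"
    by (simp add: product_append)
  have "(z', y') \<notin> set (List.product (us @ [z]) S)" "(z, y) \<notin> set (List.product vs S)"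
    using assms by auto
  from alen_two_blocks[OF this]
  show "alen (z, y) (z', y') (List.product (us @ z # vs) S) \<le> 2"
    and "alen (z', y') (z, y) (List.product (us @ z # vs) S) \<le> 1"
    unfolding eq by auto
qed

lemma split_list_two [consumes 3]:
  assumes "z \<in> set zs" "z' \<in> set zs" "z \<noteq> z'"
  obtains (before) us vs where "zs = us @ z # vs" "z' \<in> set vs"
  | (after) us vs where "zs = us @ z' # vs" "z \<in> set vs"
proof -
  obtain us vs where zs: "zs = us @ z # vs" using assms(1) by (meson split_list)
  show thesis
  proof (cases "z' \<in> set vs")
    case True
    then show thesis using that(1) zs by blast
  next
    case False
    then have "z' \<in> set us" using assms zs by auto
    then obtain us' vs' where "us = us' @ z' # vs'" by (meson split_list)
    then show thesis using that(2)[of us' "vs' @ z # vs"] zs by simp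
  qed
qed

lemma alen_product_diff:
  assumes "distinct zs" "z \<noteq> z'"
  shows "alen (z, y) (z', y') (List.product zs S) \<le> 2"
proof (cases "z \<in> set zs \<and> z' \<in> set zs")
  case True
  then have "z \<in> set zs" "z' \<in> set zs" by auto
  from this assms(2) show ?thesis
  proof (cases rule: split_list_two)
    case (before us vs)
    then show ?thesis using alen_product_blocks(1) assms(1) by metis
  next
    case (after us vs)
    then show ?thesis using alen_product_blocks(2)[of us z' vs z y y' S] assms(1) by simp
  qed
next
  case False
  then have "(z, y) \<notin> set (List.product zs S) \<or> (z', y') \<notin> set (List.product zs S)" by auto
  then show ?thesis
    using alen_notin[of "(z, y)" "List.product zs S" "(z', y')"]
      alen_le_one[of "(z', y')" "List.product zs S" "(z, y)"] by auto
qed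

lemma distinct_adj_product:
  assumes "distinct zs" "distinct_adj S"
  shows "distinct_adj (List.product zs S)"
  using assms(1)
proof (induction zs)
  case (Cons z zs)
  have "last (map (Pair z) S) \<noteq> hd (List.product zs S)"
    if "S \<noteq> []" "List.product zs S \<noteq> []"
  proof -
    have "hd (List.product zs S) \<in> set zs \<times> set S"
      using hd_in_set[OF that(2)] by simp
    then show ?thesis using Cons.prems that by (auto simp: last_map)
  qed
  then show ?case
    using Cons assms(2) by (auto simp: distinct_adj_append_iff distinct_adj_map_iff inj_on_def)
qed simp

text \<open>Letters of one copy alternate as in \<open>S\<close>. Letters of different copies form
  two blocks, so they alternate at most twice, which \<open>s \<ge> 1\<close> permits.\<close>

lemma product_in_DS:
  assumes "S \<in> DS s n" "distinct zs" "s \<ge> 1"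
  shows "List.product zs S \<in> DS s (length zs * n)"
proof -
  have "alen (z, y) (z', y') (List.product zs S) \<le> s + 1" if "(z, y) \<noteq> (z', y')" for z y z' y'
  proof (cases "z = z'")
    case True
    then show ?thesis
      using that assms alen_product_same[of zs z y y' S] alen_notin[of "(z, y)" "List.product zs S"]
      by (cases "z \<in> set zs") (auto simp: DS_iff)
  next
    case False
    then show ?thesis using alen_product_diff[OF assms(2) False, of y y' S] assms(3) by simp
  qed
  then show ?thesis
    using assms distinct_adj_product[of zs S]
    by (auto simp: DS_iff distinct_card card_cartesian_product)
qed

section \<open>Orders by last and first occurrence\<close>

text \<open>Since \<open>remdups\<close> keeps last occurrences, \<open>rev (remdups S)\<close>
  lists the symbols by decreasing position of the last occurrence.\<close>

lemma rev_remdups_order: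
  assumes "rev (remdups S) = us @ y # vs" "y' \<in> set vs"
  shows "\<exists>U V. S = U @ y # V \<and> y \<notin> set V \<and> y' \<notin> set V"
  using assms
proof (induction S arbitrary: vs)
  case (Cons x T)
  show ?case
  proof (cases "x \<in> set T")
    case True
    then obtain U V where "T = U @ y # V \<and> y \<notin> set V \<and> y' \<notin> set V"
      using Cons.IH[of vs] Cons.prems by auto
    then show ?thesis by (intro exI[of _ "x # U"] exI[of _ V]) simp
  next
    case False
    obtain vs' where vs: "vs = vs' @ [x]" and T: "rev (remdups T) = us @ y # vs'"
    proof (cases vs rule: rev_cases)
      case Nil
      then show thesis using Cons.prems by simp
    next
      case (snoc ws w)
      then show thesis using that Cons.prems False by simp
    qed
    have "\<exists>U V. T = U @ y # V \<and> y \<notin> set V \<and> y' \<notin> set V"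
    proof (cases "y' \<in> set vs'")
      case True
      then show ?thesis using Cons.IH T by blast
    next
      \<comment> \<open>Here \<open>y'\<close> is the head \<open>x\<close>, which does not recur in
        \<open>T\<close>, so the last \<open>y\<close> of \<open>T\<close> comes after it.\<close>
      case y': False
      have "y \<in> set (rev (remdups T))" unfolding T by simp
      then have "y \<in> set T" by simp
      then obtain U V where "T = U @ y # V" "y \<notin> set V" by (meson split_list_last)
      moreover have "y' = x" using y' vs Cons.prems by simp
      ultimately show ?thesis using False by auto
    qed
    then obtain U V where "T = U @ y # V \<and> y \<notin> set V \<and> y' \<notin> set V" by blast
    then show ?thesis by (intro exI[of _ "x # U"] exI[of _ V]) simp
  qed
qed simp

text \<open>The mirror image: last occurrences in \<open>rev S\<close> are first occurrences in
  \<open>S\<close>, listed by decreasing position.\<close>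

lemma remdups_rev_order:
  assumes "remdups (rev S) = us @ x # vs" "x' \<in> set vs"
  shows "\<exists>U V. S = V @ x' # U \<and> x \<notin> set V \<and> x' \<notin> set V"
proof -
  obtain ps qs where "vs = ps @ x' # qs" using assms(2) by (meson split_list)
  then have "rev (remdups (rev S)) = rev qs @ x' # (rev ps @ x # rev us)"
    using assms(1) by simp
  then obtain U V where *: "rev S = U @ x' # V" "x' \<notin> set V" "x \<notin> set V"
    using rev_remdups_order[of "rev S" "rev qs" x' "rev ps @ x # rev us" x] by auto
  then have "S = rev V @ x' # rev U" using arg_cong[OF *(1), of rev] unfolding rev_rev_ident by simp
  then show ?thesis using * by (intro exI[of _ "rev U"] exI[of _ "rev V"]) simp
qed

text \<open>The greedy alternation ends in the letter that occurs last.\<close>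

lemma alen_parity:
  assumes "S = U @ y # V" "y \<notin> set V" "y' \<notin> set V" "y \<noteq> y'"
  shows "odd (alen y y' S)" "even (alen y' y S)"
  using assms by (auto simp: alen_append alen_notin)

section \<open>The grid raises the order by one\<close>

text \<open>The first coordinate names the row, the second the column; the swap turns rows into
  columns.\<close>

definition grid :: "'a list \<Rightarrow> ('a \<times> 'a) list" where
  "grid S = List.product (remdups (rev S)) S @ map prod.swap (List.product (rev (remdups S)) S)"

lemma alen_map_swap: "alen (x, y) (x', y') (map prod.swap xs) = alen (y, x) (y', x') xs"
  using alen_map[OF inj_swap, where a = "(y, x)" and b = "(y', x')"] by simp

text \<open>Row \<open>x\<close> gives a copy of \<open>S\<close>, followed by a block of
  \<open>y\<close> and then one of \<open>y'\<close> from the columns. Of the two letters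
  \<open>y\<close> is last in \<open>S\<close>, so its block merges with the end of the copy and
  only \<open>y'\<close> can add a letter.\<close>

lemma alen_grid_row:
  assumes S: "S \<in> DS s n" and xy: "x \<in> set S"
    and split: "rev (remdups S) = us @ y # vs" "y' \<in> set vs"
  shows "alen (x, y) (x, y') (grid S) \<le> s + 2" "alen (x, y') (x, y) (grid S) \<le> s + 2"
proof -
  let ?C = "List.product (rev (remdups S)) S"
  have d: "distinct (us @ y # vs)" using split(1) distinct_remdups distinct_rev by metis
  have ne: "y \<noteq> y'" using d split(2) by auto
  have C: "alen (y', x) (y, x) ?C \<le> 1"
    using alen_product_blocks(2)[OF d split(2)] split(1) by simp
  have rows: "alen (x, u) (x, v) (List.product (remdups (rev S)) S) = alen u v S" for u v
    using xy by (intro alen_product_same) auto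
  obtain U V where "S = U @ y # V" "y \<notin> set V" "y' \<notin> set V"
    using rev_remdups_order[OF split] by blast
  note parity = alen_parity[OF this ne]
  have "alen y y' S \<le> s + 1" "alen y' y S \<le> s + 1"
    using S ne by (auto simp: DS_iff)
  with C parity
  show "alen (x, y) (x, y') (grid S) \<le> s + 2" "alen (x, y') (x, y) (grid S) \<le> s + 2"
    by (auto simp: grid_def alen_append rows alen_map_swap)
qed

text \<open>The rows give a block of \<open>x\<close> and then one of \<open>x'\<close>, followed by
  a copy of \<open>S\<close> in column \<open>y\<close>. Of the two letters \<open>x'\<close> is
  first in \<open>S\<close>, so its block merges with the start of the copy and only
  \<open>x\<close> can add a letter.\<close>

lemma alen_grid_column:
  assumes S: "S \<in> DS s n" and xy: "y \<in> set S"
    and split: "remdups (rev S) = us @ x # vs" "x' \<in> set vs"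
  shows "alen (x, y) (x', y) (grid S) \<le> s + 2" "alen (x', y) (x, y) (grid S) \<le> s + 2"
proof -
  let ?R = "List.product (remdups (rev S)) S"
  have d: "distinct (us @ x # vs)" using split(1) distinct_remdups by metis
  have ne: "x \<noteq> x'" using d split(2) by auto
  have R: "alen (x, y) (x', y) ?R \<le> 2" "alen (x', y) (x, y) ?R \<le> 1"
    using alen_product_blocks[OF d split(2)] split(1) by simp_all
  have cols: "alen (u, y) (v, y) (map prod.swap (List.product (rev (remdups S)) S)) = alen u v S"
    for u v
    using xy unfolding alen_map_swap by (intro alen_product_same) auto
  obtain U V where "S = V @ x' # U" "x \<notin> set V" "x' \<notin> set V"
    using remdups_rev_order[OF split] by blast
  \<comment> \<open>An alternation from \<open>x\<close> has to skip the leading \<open>x'\<close>,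
    which can be put in front of it.\<close>
  then have "alen x' x S = Suc (alen x x' S)"
    using ne by (simp add: alen_append alen_notin)
  moreover have "alen x' x S \<le> s + 1"
    using S ne by (auto simp: DS_iff)
  moreover have "alen (x, y) (x', y) ?R \<in> {0, 1, 2}" "alen (x', y) (x, y) ?R \<in> {0, 1}"
    using R by auto
  ultimately
  show "alen (x, y) (x', y) (grid S) \<le> s + 2" "alen (x', y) (x, y) (grid S) \<le> s + 2"
    by (auto simp: grid_def alen_append cols)
qed

lemma alen_grid:
  assumes S: "S \<in> DS s n" and s: "s \<ge> 2" and ne: "p \<noteq> q"
  shows "alen p q (grid S) \<le> s + 2"
proof (cases "p \<in> set S \<times> set S \<and> q \<in> set S \<times> set S")
  case False
  moreover have "set (grid S) = set S \<times> set S"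
    by (auto simp: grid_def)
  ultimately show ?thesis
    using alen_notin[of p "grid S" q] alen_le_one[of q "grid S" p] by auto
next
  case True
  then obtain x y x' y' where
    p: "p = (x, y)" "x \<in> set S" "y \<in> set S" and q: "q = (x', y')" "x' \<in> set S" "y' \<in> set S"
    by auto
  consider "x = x'" "y \<noteq> y'" | "x \<noteq> x'" "y = y'" | "x \<noteq> x'" "y \<noteq> y'" using ne p q by blast
  then show ?thesis
  proof cases
    case 1
    have "y \<in> set (rev (remdups S))" "y' \<in> set (rev (remdups S))" using p q by auto
    from this 1(2) show ?thesis
    proof (cases rule: split_list_two)
      case (before us vs)
      then show ?thesis using alen_grid_row(1)[OF S p(2)] 1 p q by blast
    next
      case (after us vs)
      then show ?thesis using alen_grid_row(2)[OF S p(2)] 1 p q by blast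
    qed
  next
    case 2
    have "x \<in> set (remdups (rev S))" "x' \<in> set (remdups (rev S))" using p q by auto
    from this 2(1) show ?thesis
    proof (cases rule: split_list_two)
      case (before us vs)
      then show ?thesis using alen_grid_column(1)[OF S p(3)] 2 p q by blast
    next
      case (after us vs)
      then show ?thesis using alen_grid_column(2)[OF S p(3)] 2 p q by blast
    qed
  next
    \<comment> \<open>Points on no common line form two blocks in each half, so they alternate at
      most \<open>2 + 2\<close> times; this is where \<open>s \<ge> 2\<close> enters.\<close>
    case 3
    have R: "alen (x, y) (x', y') (List.product (remdups (rev S)) S) \<le> 2"
      using 3 by (intro alen_product_diff) auto
    have C: "alen (u, v) (u', v') (map prod.swap (List.product (rev (remdups S)) S)) \<le> 2"
      if "v \<noteq> v'" for u v u' v'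
      using that unfolding alen_map_swap by (intro alen_product_diff) auto
    show ?thesis
      using R C[of y y' x x'] C[of y' y x' x] 3 s by (simp add: p q grid_def alen_append)
  qed
qed

section \<open>Squaring the alphabet and iterating\<close>

text \<open>If the seam repeats a letter, the head of \<open>B\<close> is dropped; the end of
  \<open>A\<close> keeps that letter in the alphabet.\<close>

lemma distinct_adj_join:
  assumes "distinct_adj A" "distinct_adj B" "A \<noteq> []"
  obtains C where "distinct_adj C" "subseq C (A @ B)" "set C = set A \<union> set B"
    "length A + length B \<le> Suc (length C)"
proof (cases "B \<noteq> [] \<and> last A = hd B")
  case True
  then obtain b B' where B: "B = b # B'" "last A = b" by (cases B) auto
  show thesis
  proof (rule that[of "A @ B'"])
    show "distinct_adj (A @ B')"
      using assms B by (auto simp: distinct_adj_append_iff distinct_adj_Cons)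
    show "set (A @ B') = set A \<union> set B"
      using B assms(3) last_in_set by auto
    show "subseq (A @ B') (A @ B)"
      using B by (auto simp: subseq_append' intro: list_emb_Cons)
  qed (use B in simp)
next
  case False
  then show thesis
    using assms by (intro that[of "A @ B"]) (auto simp: distinct_adj_append_iff)
qed

lemma DS_square:
  assumes S: "S \<in> DS s n" and "s \<ge> 2" "n > 0"
  obtains T :: "('a \<times> 'a) list"
  where "T \<in> DS (Suc s) (n * n)" "2 * n * length (S :: 'a list) \<le> Suc (length T)"
proof -
  let ?A = "List.product (remdups (rev S)) S"
  let ?B = "map prod.swap (List.product (rev (remdups S)) S)"
  have adj: "distinct_adj S" and card: "card (set S) = n"
    using S by (auto simp: DS_iff)
  have len: "length (remdups (rev S)) = n" "length (remdups S) = n"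
    using card by (auto simp: length_remdups_card_conv)
  have "distinct_adj ?A" "distinct_adj ?B"
    using adj by (auto simp: distinct_adj_map_iff intro!: distinct_adj_product)
  moreover have "length ?A = n * length S" "length ?B = n * length S"
    using len by simp_all
  moreover from this have "?A \<noteq> []"
    using card \<open>n > 0\<close> by (metis card.empty length_0_conv less_irrefl list.set(1) mult_is_0)
  ultimately obtain T where T: "distinct_adj T" "subseq T (grid S)" "set T = set ?A \<union> set ?B"
    "n * length S + n * length S \<le> Suc (length T)"
    using distinct_adj_join[of ?A ?B] unfolding grid_def by metis
  have "set T = set S \<times> set S" using T(3) by auto
  then have "card (set T) = n * n" using card by (simp add: card_cartesian_product)
  moreover have "alen a b T \<le> Suc s + 1" if "a \<noteq> b" for a b
    using alen_subseq[OF T(2)] alen_grid[OF S assms(2) that]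
    by (metis add_Suc_shift le_trans one_add_one plus_1_eq_Suc)
  ultimately have "T \<in> DS (Suc s) (n * n)" using T(1) by (simp add: DS_iff)
  then show thesis using T(4) by (intro that) (simp_all add: distrib_right mult_2)
qed

text \<open>The summand \<open>+ 2\<close> strengthens the induction so that it absorbs the letter
  lost at each seam. The base \<open>0 1 0\<close> attains equality,
  \<open>2 * (4 + 2) = 4 * 3\<close>.\<close>

lemma DS_doubly_exponential:
  "\<exists>S :: nat list. S \<in> DS (t + 2) (2 ^ 2 ^ t) \<and> 2 ^ 2 ^ t * (2 ^ (t + 2) + 2) \<le> 4 * length S"
proof (induction t)
  case 0
  have "alen a b [0, 1, 0 :: nat] \<le> 3" for a b by simp
  moreover have "set [0, 1, 0 :: nat] = {0, 1}" by auto
  ultimately have "[0, 1, 0 :: nat] \<in> DS 2 2"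
    unfolding DS_iff by simp
  then show ?case by (intro exI[of _ "[0, 1, 0]"]) (simp add: numeral_2_eq_2)
next
  case (Suc t)
  let ?N = "2 ^ 2 ^ t :: nat"
  obtain S :: "nat list" where
    S: "S \<in> DS (t + 2) ?N" and len: "?N * (2 ^ (t + 2) + 2) \<le> 4 * length S"
    using Suc by blast
  obtain T :: "(nat \<times> nat) list" where T: "T \<in> DS (Suc (t + 2)) (?N * ?N)" "2 * ?N * length S \<le> Suc (length T)"
    by (rule DS_square[OF S]) simp_all
  have N: "?N * ?N = 2 ^ 2 ^ Suc t" by (simp add: power_add[symmetric] mult_2)
  have "2 * ?N * (?N * (2 ^ (t + 2) + 2)) \<le> 2 * ?N * (4 * length S)"
    using len by (intro mult_left_mono) auto
  also have "\<dots> \<le> 4 * length T + 4" using T(2) by simp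
  \<comment> \<open>Doubling turns \<open>+ 2\<close> into \<open>+ 4\<close>; the surplus
    \<open>2 * (?N * ?N)\<close> is at least 8 and pays for the 4 on the right.\<close>
  finally have "(?N * ?N) * (2 ^ (Suc t + 2) + 2) + 2 * (?N * ?N) \<le> 4 * length T + 4"
    by (simp add: algebra_simps)
  moreover have "2 \<le> ?N" using self_le_power[of 2 "2 ^ t"] by simp
  then have "2 * 2 \<le> ?N * ?N" by (intro mult_mono) auto
  ultimately have "2 ^ 2 ^ Suc t * (2 ^ (Suc t + 2) + 2) \<le> 4 * length T"
    unfolding N by linarith
  \<comment> \<open>Coding pairs as numbers keeps the induction in one type.\<close>
  moreover have "map prod_encode T \<in> DS (Suc t + 2) (2 ^ 2 ^ Suc t)"
    using DS_map[OF T(1) inj_prod_encode[of UNIV]] N by simp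
  ultimately show ?case by (intro exI[of _ "map prod_encode T"]) simp
qed

section \<open>Arbitrary alphabet sizes\<close>

lemma length_le_ds_lambda: "S \<in> DS s n \<Longrightarrow> length (S :: nat list) \<le> ds_lambda s n"
  unfolding ds_lambda_def by (intro Max_ge finite_length_DS imageI)

text \<open>A fresh letter appended at the end alternates at most twice with any other
  letter.\<close>

lemma ds_lambda_Suc:
  assumes "s \<ge> 1"
  shows "ds_lambda s n \<le> ds_lambda s (Suc n)"
proof -
  have "length S \<le> ds_lambda s (Suc n)" if S: "S \<in> DS s n" for S :: "nat list"
  proof -
    obtain x where x: "x \<notin> set S" using ex_new_if_finite[OF infinite_UNIV_nat] by blast
    have "alen a b (S @ [x]) \<le> s + 1" if "a \<noteq> b" for a b
    proof (cases "a = x \<or> b = x")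
      case True
      then show ?thesis
        using x assms that alen_notin[of x S b] alen_le_one[of x S a] alen_notin[of x S a]
        by (auto simp: alen_append)
    next
      case False
      then show ?thesis using S that by (auto simp: alen_append DS_iff)
    qed
    moreover have "distinct_adj (S @ [x])"
      using S x last_in_set[of S] by (auto simp: DS_iff distinct_adj_append_iff)
    ultimately have "S @ [x] \<in> DS s (Suc n)"
      using S x by (simp add: DS_iff)
    then show ?thesis using length_le_ds_lambda by fastforce
  qed
  moreover have "DS s n \<noteq> ({} :: nat list set)" using upt_in_DS[OF assms] by blast
  ultimately show ?thesis
    unfolding ds_lambda_def[of s n] by (intro Max.boundedI finite_length_DS) auto
qed

lemma ds_lambda_mono: "s \<ge> 1 \<Longrightarrow> m \<le> n \<Longrightarrow> ds_lambda s m \<le> ds_lambda s n"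
  using lift_Suc_mono_le[of "ds_lambda s", OF ds_lambda_Suc] by blast

text \<open>Uses \<open>n div ?N\<close> disjoint copies of the sequence on \<open>?N\<close>
  symbols. The 8 is the 4 of \<open>DS_doubly_exponential\<close> times 2 for rounding
  \<open>n\<close> down to a multiple of \<open>?N\<close>.\<close>

lemma ds_lambda_ge:
  assumes "2 ^ 2 ^ t \<le> n"
  shows "n * 2 ^ (t + 2) \<le> 8 * ds_lambda (t + 2) n"
proof -
  let ?N = "2 ^ 2 ^ t :: nat"
  let ?k = "n div ?N"
  obtain S :: "nat list" where
    S: "S \<in> DS (t + 2) ?N" and len: "?N * (2 ^ (t + 2) + 2) \<le> 4 * length S"
    using DS_doubly_exponential by blast
  have "List.product [0..<?k] S \<in> DS (t + 2) (?k * ?N)"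
    using product_in_DS[OF S, of "[0..<?k]"] by simp
  then have "map prod_encode (List.product [0..<?k] S) \<in> DS (t + 2) (?k * ?N)"
    using DS_map inj_prod_encode by blast
  then have "?k * length S \<le> ds_lambda (t + 2) (?k * ?N)"
    using length_le_ds_lambda by fastforce
  also have "\<dots> \<le> ds_lambda (t + 2) n"
    by (intro ds_lambda_mono) auto
  finally have kL: "?k * length S \<le> ds_lambda (t + 2) n" .
  \<comment> \<open>With at least one full copy, the remainder is smaller than the part
    covered.\<close>
  have "1 \<le> ?k" using div_le_mono[OF assms, of ?N] by simp
  then have "?N \<le> ?k * ?N" by simp
  moreover have "n < ?k * ?N + ?N" using dividend_less_div_times[of ?N n] by simp
  ultimately have "n \<le> 2 * (?k * ?N)" by linarith
  then have "n * 2 ^ (t + 2) \<le> 2 * (?k * ?N) * 2 ^ (t + 2)" by (rule mult_right_mono) simp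
  also have "\<dots> = 2 * ?k * (?N * 2 ^ (t + 2))" by (simp only: mult.assoc)
  also have "\<dots> \<le> 2 * ?k * (4 * length S)"
    using len by (intro mult_left_mono) (auto simp: algebra_simps)
  also have "\<dots> \<le> 8 * ds_lambda (t + 2) n" using kL by simp
  finally show ?thesis .
qed

theorem theorem2:
  "\<exists>c::real. c > 0 \<and>
     (\<forall>n s::nat. n \<ge> 2 \<longrightarrow> s \<ge> 1 \<longrightarrow> real s \<le> log 2 (log 2 (real n)) + 2 \<longrightarrow>
        real (ds_lambda s n) \<ge> c * real n * 2 ^ s)"
proof (intro exI[of _ "1/8"] conjI allI impI)
  fix n s :: nat
  assume n: "n \<ge> 2" and s: "s \<ge> 1" and le: "real s \<le> log 2 (log 2 (real n)) + 2"
  have "n * 2 ^ s \<le> 8 * ds_lambda s n"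
  \<comment> \<open>The construction starts at order 2; for order 1 the list of \<open>n\<close>
    distinct symbols suffices, as \<open>2 * n \<le> 8 * n\<close>.\<close>
  proof (cases "s = 1")
    case True
    then show ?thesis using length_le_ds_lambda[OF upt_in_DS[of s n]] by simp
  next
    case False
    then obtain t where t: "s = t + 2" using s
      by (metis One_nat_def Suc_1 le_antisym le_add_diff_inverse2 not_less_eq_eq)
    \<comment> \<open>Positivity of the inner logarithm allows exponentiating twice, which gives
      \<open>2 ^ 2 ^ t \<le> n\<close>.\<close>
    have "log 2 2 \<le> log 2 (real n)" using n by (subst log_le_cancel_iff) auto
    then have pos: "log 2 (real n) > 0" by simp
    have "real t \<le> log 2 (log 2 (real n))" using le t by simp
    then have "2 powr real t \<le> log 2 (real n)" using pos by (simp add: le_log_iff)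
    then have "real (2 ^ t) \<le> log 2 (real n)" by (simp add: powr_realpow)
    then have "2 powr real (2 ^ t) \<le> real n" using n by (subst (asm) le_log_iff) auto
    moreover have "2 powr real (2 ^ t) = real (2 ^ 2 ^ t)" by (subst powr_realpow) simp_all
    ultimately have "real (2 ^ 2 ^ t) \<le> real n" by (simp only:)
    then have "2 ^ 2 ^ t \<le> n" by (simp only: of_nat_le_iff)
    then show ?thesis using ds_lambda_ge t by simp
  qed
  then have "real (n * 2 ^ s) \<le> real (8 * ds_lambda s n)" by (simp only: of_nat_le_iff)
  then show "1 / 8 * real n * 2 ^ s \<le> real (ds_lambda s n)" by simp
qed simp

end
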